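(* Let $\Omega$ be a finite set, let $\beta > 0$, and let $(J_B)_{B \subseteq \Omega}$ and $(J'_B)_{B \subseteq \Omega}$ be two families of real numbers indexed by the subsets of $\Omega$ such that $J_B \geq 0$ and $|J'_B| \leq J_B$ for every $B \subseteq \Omega$. Let $\langle \cdot \rangle$ and $\langle \cdot \rangle'$ denote the thermal averages at inverse temperature $\beta$ of the Ising systems on $\Omega$ with couplings $(J_B)$ and $(J'_B)$ respectively. Then for every subset $A \subseteq \Omega$, $$\langle \sigma_A \rangle \geq \left| \langle \sigma_A \rangle' \right|.$$
   Context: An Ising spin configuration on the finite set of sites $\Omega$ is a function $\sigma : \Omega \to \{-1, +1\}$, $i \mapsto \sigma_i$. For $A \subseteq \Omega$, write $\sigma_A = \prod_{i \in A} \sigma_i$ (with $\sigma_\emptyset = 1$). The two systems have Hamiltonians $$H(\sigma) = -\sum_{B \subseteq \Omega} J_B \sigma_B, \qquad H'(\sigma) = -\sum_{B \subseteq \Omega} J'_B \sigma_B,$$ where the sums run over all subsets $B$ of $\Omega$. The thermal averages at inverse temperature $\beta$ are $$\langle \sigma_A \rangle = \frac{\sum_{\sigma} \sigma_A e^{-\beta H(\sigma)}}{\sum_{\sigma} e^{-\beta H(\sigma)}}, \qquad \langle \sigma_A \rangle' = \frac{\sum_{\sigma} \sigma_A e^{-\beta H'(\sigma)}}{\sum_{\sigma} e^{-\beta H'(\sigma)}},$$ where the sums over $\sigma$ run over all configurations $\sigma \in \{-1,+1\}^{\Omega}$. *)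

theory Defs
  imports Complex_Main "HOL-Library.FuncSet"
begin

(* The extensional function space makes a configuration determined by its values on \<Omega>,
   so that each spin configuration occurs exactly once in sums over "configurations \<Omega>". *)
definition configurations :: "'a set \<Rightarrow> ('a \<Rightarrow> real) set" where
  "configurations \<Omega> = (\<Omega> \<rightarrow>\<^sub>E {-1, 1})"

definition spin_prod :: "'a set \<Rightarrow> ('a \<Rightarrow> real) \<Rightarrow> real" where
  "spin_prod A \<sigma> = (\<Prod>i\<in>A. \<sigma> i)"

definition hamiltonian :: "'a set \<Rightarrow> ('a set \<Rightarrow> real) \<Rightarrow> ('a \<Rightarrow> real) \<Rightarrow> real" where
  "hamiltonian \<Omega> J \<sigma> = - (\<Sum>B\<in>Pow \<Omega>. J B * spin_prod B \<sigma>)"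

definition thermal_average ::
  "'a set \<Rightarrow> real \<Rightarrow> ('a set \<Rightarrow> real) \<Rightarrow> (('a \<Rightarrow> real) \<Rightarrow> real) \<Rightarrow> real" where
  "thermal_average \<Omega> \<beta> J f =
     (\<Sum>\<sigma>\<in>configurations \<Omega>. f \<sigma> * exp (- \<beta> * hamiltonian \<Omega> J \<sigma>)) /
     (\<Sum>\<sigma>\<in>configurations \<Omega>. exp (- \<beta> * hamiltonian \<Omega> J \<sigma>))"

end

theory Submission
  imports Defs
begin

text \<open>Ginibre's duplication argument: clearing denominators, the claim says that the sum over pairs
  $(\sigma, \tau)$ of $(\sigma_A \pm \tau_A) e^{-\beta H(\sigma) - \beta H'(\tau)}$ is nonnegative.
  Substituting $\tau = \sigma s$ turns the summand into
  $(1 \pm s_A)\, \sigma_A \exp(\beta \sum_B (J_B + J'_B s_B) \sigma_B)$. For fixed $s$ the couplings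
  $J_B + J'_B s_B$ are nonnegative, so Griffiths' first inequality applies to the sum over
  $\sigma$.\<close>

lemma finite_configurations: "finite \<Omega> \<Longrightarrow> finite (configurations \<Omega>)"
  by (simp add: configurations_def finite_PiE)

lemma configurations_nonempty: "configurations \<Omega> \<noteq> {}"
  by (simp add: configurations_def PiE_eq_empty_iff)

lemma configurations_value:
  "\<sigma> \<in> configurations \<Omega> \<Longrightarrow> i \<in> \<Omega> \<Longrightarrow> \<sigma> i = -1 \<or> \<sigma> i = 1"
  by (auto simp: configurations_def PiE_iff)

lemma configurations_square:
  "\<sigma> \<in> configurations \<Omega> \<Longrightarrow> i \<in> \<Omega> \<Longrightarrow> \<sigma> i * \<sigma> i = 1"
  using configurations_value by fastforce

lemma spin_prod_square:
  assumes "\<sigma> \<in> configurations \<Omega>" "A \<subseteq> \<Omega>"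
  shows "spin_prod A \<sigma> * spin_prod A \<sigma> = 1"
  using assms by (auto simp: spin_prod_def configurations_square simp flip: prod.distrib
      intro!: prod.neutral)

lemma spin_prod_cases:
  assumes "\<sigma> \<in> configurations \<Omega>" "A \<subseteq> \<Omega>"
  shows "spin_prod A \<sigma> = -1 \<or> spin_prod A \<sigma> = 1"
  using spin_prod_square[OF assms] square_eq_1_iff by blast

text \<open>Sites in \<open>A \<inter> B\<close> occur twice and contribute a square equal to 1.
  Spin products are thus closed under multiplication, which keeps the induction for Griffiths'
  inequality going.\<close>

lemma spin_prod_symm_diff:
  assumes "finite \<Omega>" "\<sigma> \<in> configurations \<Omega>" "A \<subseteq> \<Omega>" "B \<subseteq> \<Omega>"
  shows "spin_prod A \<sigma> * spin_prod B \<sigma> = spin_prod ((A - B) \<union> (B - A)) \<sigma>"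
proof -
  have fin: "finite A" "finite B"
    using assms finite_subset by blast+
  have split: "spin_prod C \<sigma> = spin_prod (C - D) \<sigma> * spin_prod (C \<inter> D) \<sigma>"
    if "finite C" for C D
    using that prod.Int_Diff[of C \<sigma> D] by (simp add: spin_prod_def mult.commute)
  have "spin_prod A \<sigma> * spin_prod B \<sigma> = spin_prod (A - B) \<sigma> * spin_prod (B - A) \<sigma> *
      (spin_prod (A \<inter> B) \<sigma> * spin_prod (A \<inter> B) \<sigma>)"
    using split[OF fin(1), of B] split[OF fin(2), of A] by (simp add: Int_commute)
  also have "\<dots> = spin_prod (A - B) \<sigma> * spin_prod (B - A) \<sigma>"
    using spin_prod_square[OF assms(2), of "A \<inter> B"] assms(3) by auto
  also have "\<dots> = spin_prod ((A - B) \<union> (B - A)) \<sigma>"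
    unfolding spin_prod_def using fin by (intro prod.union_disjoint[symmetric]) auto
  finally show ?thesis .
qed

text \<open>The sum factorises over sites: a site in \<open>A\<close> contributes -1 + 1 = 0, any
  other site contributes 2. This is the case without interactions.\<close>

lemma sum_spin_prod_nonneg:
  assumes "finite \<Omega>" "A \<subseteq> \<Omega>"
  shows "(\<Sum>\<sigma>\<in>configurations \<Omega>. spin_prod A \<sigma>) \<ge> 0"
proof -
  have "spin_prod A \<sigma> = (\<Prod>i\<in>\<Omega>. if i \<in> A then \<sigma> i else 1)" for \<sigma>
    using assms prod.inter_restrict[of \<Omega> \<sigma> A] by (simp add: spin_prod_def Int_absorb1)
  then have "(\<Sum>\<sigma>\<in>configurations \<Omega>. spin_prod A \<sigma>)
      = (\<Prod>i\<in>\<Omega>. \<Sum>x\<in>{-1, 1}. if i \<in> A then x else 1)"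
    unfolding configurations_def using assms(1) by (subst prod_sum_PiE) auto
  also have "\<dots> \<ge> 0"
    by (intro prod_nonneg) auto
  finally show ?thesis .
qed

text \<open>On the two signs the exponential is an affine function, so a Boltzmann factor becomes a
  combination of 1 and a spin product, with nonnegative coefficients when \<open>k\<close> is
  nonnegative.\<close>

lemma exp_mult_sign:
  fixes x k :: real
  assumes "x = -1 \<or> x = 1"
  shows "exp (k * x) = cosh k + x * sinh k"
  using assms by (auto simp: cosh_plus_sinh cosh_minus_sinh)

text \<open>Induction on the set \<open>F\<close> of interacting subsets, removing one Boltzmann
  factor at a time by \<open>exp_mult_sign\<close>. The \<open>sinh\<close> term changes the
  observable from \<open>A\<close> to its symmetric difference with \<open>B\<close>, hence the
  induction is over arbitrary \<open>A\<close>.\<close>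

lemma griffiths_first_inequality:
  assumes "finite \<Omega>" "finite F" "F \<subseteq> Pow \<Omega>" "\<And>B. B \<in> F \<Longrightarrow> K B \<ge> 0" "A \<subseteq> \<Omega>"
  shows "(\<Sum>\<sigma>\<in>configurations \<Omega>. spin_prod A \<sigma> * exp (\<Sum>B\<in>F. K B * spin_prod B \<sigma>)) \<ge> 0"
  using assms(2-)
proof (induction F arbitrary: A rule: finite_induct)
  case empty
  then show ?case
    using sum_spin_prod_nonneg[OF assms(1)] by simp
next
  case (insert B F)
  define w where "w \<sigma> = exp (\<Sum>B\<in>F. K B * spin_prod B \<sigma>)" for \<sigma>
  define D where "D = (A - B) \<union> (B - A)"
  have B: "B \<subseteq> \<Omega>" and D: "D \<subseteq> \<Omega>"
    using insert.prems by (auto simp: D_def)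
  have nonneg: "(\<Sum>\<sigma>\<in>configurations \<Omega>. spin_prod C \<sigma> * w \<sigma>) \<ge> 0" if "C \<subseteq> \<Omega>" for C
    unfolding w_def using insert.prems that by (intro insert.IH) auto
  have "spin_prod A \<sigma> * exp (\<Sum>B\<in>insert B F. K B * spin_prod B \<sigma>)
      = cosh (K B) * (spin_prod A \<sigma> * w \<sigma>) + sinh (K B) * (spin_prod D \<sigma> * w \<sigma>)"
    if \<sigma>: "\<sigma> \<in> configurations \<Omega>" for \<sigma>
  proof -
    have "exp (\<Sum>B\<in>insert B F. K B * spin_prod B \<sigma>)
        = (cosh (K B) + spin_prod B \<sigma> * sinh (K B)) * w \<sigma>"
      using insert.hyps exp_mult_sign[OF spin_prod_cases[OF \<sigma> B]] by (simp add: exp_add w_def)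
    moreover have "spin_prod D \<sigma> = spin_prod A \<sigma> * spin_prod B \<sigma>"
      unfolding D_def using spin_prod_symm_diff[OF assms(1) \<sigma> insert.prems(3) B] by simp
    ultimately show ?thesis
      by (simp add: algebra_simps)
  qed
  then have "(\<Sum>\<sigma>\<in>configurations \<Omega>. spin_prod A \<sigma> * exp (\<Sum>B\<in>insert B F. K B * spin_prod B \<sigma>))
      = cosh (K B) * (\<Sum>\<sigma>\<in>configurations \<Omega>. spin_prod A \<sigma> * w \<sigma>)
        + sinh (K B) * (\<Sum>\<sigma>\<in>configurations \<Omega>. spin_prod D \<sigma> * w \<sigma>)"
    by (simp add: sum.distrib sum_distrib_left)
  also have "\<dots> \<ge> 0"
    using insert.prems nonneg D by (intro add_nonneg_nonneg mult_nonneg_nonneg) auto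
  finally show ?case .
qed

text \<open>The group operation on configurations; the restriction to \<open>\<Omega>\<close> keeps
  the result extensional.\<close>

definition config_mult :: "'a set \<Rightarrow> ('a \<Rightarrow> real) \<Rightarrow> ('a \<Rightarrow> real) \<Rightarrow> 'a \<Rightarrow> real" where
  "config_mult \<Omega> \<sigma> s = (\<lambda>i\<in>\<Omega>. \<sigma> i * s i)"

lemma config_mult_in_configurations:
  assumes "\<sigma> \<in> configurations \<Omega>" "s \<in> configurations \<Omega>"
  shows "config_mult \<Omega> \<sigma> s \<in> configurations \<Omega>"
proof -
  have "\<sigma> i * s i \<in> {-1, 1}" if "i \<in> \<Omega>" for i
    using configurations_value[OF assms(1) that] configurations_value[OF assms(2) that] by auto
  then show ?thesis
    by (simp add: configurations_def config_mult_def restrict_PiE_iff)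
qed

lemma config_mult_involutive:
  assumes "\<sigma> \<in> configurations \<Omega>" "s \<in> configurations \<Omega>"
  shows "config_mult \<Omega> \<sigma> (config_mult \<Omega> \<sigma> s) = s"
proof
  fix i
  show "config_mult \<Omega> \<sigma> (config_mult \<Omega> \<sigma> s) i = s i"
  proof (cases "i \<in> \<Omega>")
    case True
    then show ?thesis
      using configurations_square[OF assms(1)] by (simp add: config_mult_def flip: mult.assoc)
  next
    case False
    \<comment> \<open>Outside \<open>\<Omega>\<close> both sides are \<open>undefined\<close>, the
      right one because \<open>s\<close> is extensional.\<close>
    then show ?thesis
      using PiE_arb[of s \<Omega> "\<lambda>_. {-1, 1}" i] assms(2)
      by (simp add: config_mult_def configurations_def)
  qed
qed

text \<open>Multiplication by a fixed \<open>\<sigma>\<close> is its own inverse and so permutes the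
  configurations; this justifies the substitution of \<open>\<sigma> s\<close> for
  \<open>\<tau>\<close>.\<close>

lemma sum_config_mult:
  assumes "\<sigma> \<in> configurations \<Omega>"
  shows "(\<Sum>\<tau>\<in>configurations \<Omega>. g \<tau>) = (\<Sum>s\<in>configurations \<Omega>. g (config_mult \<Omega> \<sigma> s))"
  using assms
  by (intro sum.reindex_bij_witness[of _ "config_mult \<Omega> \<sigma>" "config_mult \<Omega> \<sigma>"])
     (auto simp: config_mult_involutive config_mult_in_configurations)

lemma spin_prod_config_mult:
  assumes "B \<subseteq> \<Omega>"
  shows "spin_prod B (config_mult \<Omega> \<sigma> s) = spin_prod B \<sigma> * spin_prod B s"
  using assms
  by (auto simp: spin_prod_def config_mult_def simp flip: prod.distrib intro!: prod.cong)

text \<open>The parameter \<open>c\<close> treats both signs of the absolute value at once; the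
  bound on it makes the factor \<open>1 + c * spin_prod A s\<close> nonnegative.\<close>

lemma duplicated_sum_nonneg:
  fixes c \<beta> :: real
  assumes "finite \<Omega>" "\<beta> \<ge> 0" "\<bar>c\<bar> \<le> 1" "A \<subseteq> \<Omega>"
    and J: "\<And>B. B \<subseteq> \<Omega> \<Longrightarrow> \<bar>J' B\<bar> \<le> J B"
  shows "(\<Sum>\<sigma>\<in>configurations \<Omega>. \<Sum>\<tau>\<in>configurations \<Omega>. (spin_prod A \<sigma> + c * spin_prod A \<tau>) *
      (exp (- \<beta> * hamiltonian \<Omega> J \<sigma>) * exp (- \<beta> * hamiltonian \<Omega> J' \<tau>))) \<ge> 0"
proof -
  \<comment> \<open>After the substitution both Boltzmann factors merge into one for
    \<open>\<sigma>\<close>, with these effective couplings depending on \<open>s\<close>.\<close>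
  define K where "K s B = \<beta> * (J B + J' B * spin_prod B s)" for s B
  define g where "g \<sigma> \<tau> = (spin_prod A \<sigma> + c * spin_prod A \<tau>) *
      (exp (- \<beta> * hamiltonian \<Omega> J \<sigma>) * exp (- \<beta> * hamiltonian \<Omega> J' \<tau>))" for \<sigma> \<tau>
  have g: "g \<sigma> (config_mult \<Omega> \<sigma> s)
      = (1 + c * spin_prod A s) * (spin_prod A \<sigma> * exp (\<Sum>B\<in>Pow \<Omega>. K s B * spin_prod B \<sigma>))"
    for \<sigma> s
  proof -
    have "- \<beta> * hamiltonian \<Omega> J \<sigma> + - \<beta> * hamiltonian \<Omega> J' (config_mult \<Omega> \<sigma> s)
        = (\<Sum>B\<in>Pow \<Omega>. \<beta> * (J B * spin_prod B \<sigma>)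
            + \<beta> * (J' B * spin_prod B (config_mult \<Omega> \<sigma> s)))"
      by (simp add: hamiltonian_def sum_distrib_left sum.distrib sum_negf)
    also have "\<dots> = (\<Sum>B\<in>Pow \<Omega>. K s B * spin_prod B \<sigma>)"
      by (intro sum.cong refl) (simp add: K_def spin_prod_config_mult algebra_simps)
    finally have "exp (- \<beta> * hamiltonian \<Omega> J \<sigma>)
          * exp (- \<beta> * hamiltonian \<Omega> J' (config_mult \<Omega> \<sigma> s))
        = exp (\<Sum>B\<in>Pow \<Omega>. K s B * spin_prod B \<sigma>)"
      by (simp only: exp_add[symmetric])
    then show ?thesis
      unfolding g_def spin_prod_config_mult[OF assms(4)] by (simp only:) (simp add: algebra_simps)
  qed
  have "(\<Sum>\<sigma>\<in>configurations \<Omega>. \<Sum>\<tau>\<in>configurations \<Omega>. g \<sigma> \<tau>)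
      = (\<Sum>\<sigma>\<in>configurations \<Omega>. \<Sum>s\<in>configurations \<Omega>. g \<sigma> (config_mult \<Omega> \<sigma> s))"
    by (intro sum.cong refl sum_config_mult)
  also have "\<dots> = (\<Sum>s\<in>configurations \<Omega>. (1 + c * spin_prod A s) *
      (\<Sum>\<sigma>\<in>configurations \<Omega>. spin_prod A \<sigma> * exp (\<Sum>B\<in>Pow \<Omega>. K s B * spin_prod B \<sigma>)))"
    \<comment> \<open>With \<open>s\<close> as the outer variable the couplings \<open>K s\<close>
      are constant in the inner sum, as Griffiths' inequality requires.\<close>
    unfolding g sum_distrib_left by (rule sum.swap)
  also have "\<dots> \<ge> 0"
  proof (rule sum_nonneg, rule mult_nonneg_nonneg)
    fix s assume s: "s \<in> configurations \<Omega>"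
    show "0 \<le> 1 + c * spin_prod A s"
      using spin_prod_cases[OF s assms(4)] assms(3) by auto
    \<comment> \<open>Since \<open>spin_prod B s\<close> is a sign, the bracket in
      \<open>K s B\<close> is at least \<open>J B - \<bar>J' B\<bar>\<close>.\<close>
    have "K s B \<ge> 0" if "B \<in> Pow \<Omega>" for B
      using spin_prod_cases[OF s, of B] J[of B] that assms(2) unfolding K_def
      by (intro mult_nonneg_nonneg) auto
    then show "0 \<le> (\<Sum>\<sigma>\<in>configurations \<Omega>. spin_prod A \<sigma> *
        exp (\<Sum>B\<in>Pow \<Omega>. K s B * spin_prod B \<sigma>))"
      using assms by (intro griffiths_first_inequality) auto
  qed
  finally show ?thesis
    unfolding g_def .
qed

theorem mainTheorem1:
  fixes \<Omega> :: "'a set" and \<beta> :: real and J J' :: "'a set \<Rightarrow> real" and A :: "'a set"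
  assumes "finite \<Omega>"
    and "\<beta> > 0"
    and "\<And>B. B \<subseteq> \<Omega> \<Longrightarrow> J B \<ge> 0"
    and "\<And>B. B \<subseteq> \<Omega> \<Longrightarrow> \<bar>J' B\<bar> \<le> J B"
    and "A \<subseteq> \<Omega>"
  shows "thermal_average \<Omega> \<beta> J (spin_prod A) \<ge> \<bar>thermal_average \<Omega> \<beta> J' (spin_prod A)\<bar>"
proof -
  define Z where "Z I = (\<Sum>\<sigma>\<in>configurations \<Omega>. exp (- \<beta> * hamiltonian \<Omega> I \<sigma>))" for I
  define N where
    "N I = (\<Sum>\<sigma>\<in>configurations \<Omega>. spin_prod A \<sigma> * exp (- \<beta> * hamiltonian \<Omega> I \<sigma>))" for I
  have Z: "Z I > 0" for I
    unfolding Z_def using finite_configurations[OF assms(1)] configurations_nonempty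
    by (intro sum_pos) auto
  \<comment> \<open>This is \<open>N J / Z J + c * (N J' / Z J')\<close> with denominators cleared;
    each product of sums is a sum over two independent copies of the configurations.\<close>
  have ineq: "N J * Z J' + c * (N J' * Z J) \<ge> 0" if "\<bar>c\<bar> \<le> 1" for c
  proof -
    have "N J * Z J' + c * (Z J * N J') = (\<Sum>\<sigma>\<in>configurations \<Omega>. \<Sum>\<tau>\<in>configurations \<Omega>.
        (spin_prod A \<sigma> + c * spin_prod A \<tau>) *
        (exp (- \<beta> * hamiltonian \<Omega> J \<sigma>) * exp (- \<beta> * hamiltonian \<Omega> J' \<tau>)))"
      unfolding N_def Z_def sum_product unfolding sum_distrib_left sum.distrib[symmetric]
      by (intro sum.cong refl) (simp add: algebra_simps)
    then show ?thesis
      using duplicated_sum_nonneg[of \<Omega> \<beta> c A J' J] assms that by (simp add: mult.commute)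
  qed
  \<comment> \<open>The values 1 and -1 of \<open>c\<close> bound \<open>N J' * Z J\<close> from
    below and from above.\<close>
  have "\<bar>N J'\<bar> * Z J \<le> N J * Z J'"
    using ineq[of 1] ineq[of "-1"] Z[of J] by (auto simp: abs_if)
  then have "\<bar>N J' / Z J'\<bar> \<le> N J / Z J"
    using Z[of J] Z[of J'] by (simp add: field_simps)
  then show ?thesis
    by (simp add: thermal_average_def N_def Z_def)
qed

end
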